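(* The price of anarchy, with respect to liquid welfare, of coarse correlated equilibria of simultaneous first-price auctions with budget-constrained bidders under the restricted uniform bidding interface is at most $$\frac{2+\mathcal W_0(-e^{-2})}{1+\mathcal W_0(-e^{-2})}\approx2.188.$$ That is, for every such instance $I$ and every coarse correlated equilibrium $A$ of $I$, $\mathrm{OPT}(I)\le\frac{2+\mathcal W_0(-e^{-2})}{1+\mathcal W_0(-e^{-2})}\,\mathrm{LW}(I,A)$.
   Context: $\mathcal W_0$ is the principal real branch of the Lambert function: $\mathcal W_0(-e^{-2})$ is the unique $w\in[-1,0)$ with $we^w=-e^{-2}$. Uniform bidding interface: bidders $N=[n]$, $n\ge2$; items $M=[m]$, $m\ge1$. Bidder $i$ has an additive valuation $v_i(S)=\sum_{j\in S}v_{ij}$, $v_{ij}\ge0$, and a budget $B_i\in(0,\infty]$. The action of bidder $i$ is a single bid multiplier $\alpha_i\in\mathcal A_i=[0,1]$, which induces the bid $\alpha_iv_{ij}$ on each item $j$; $\mathcal A=[0,1]^n$. Each item $j$ is awarded to exactly one bidder among those with the highest bid on $j$, ties being resolved by a fixed order over bidders; $X_i(\alpha)\subseteq M$ is the set of items won by $i$ and $i$ pays (first-price) $P_i(\alpha)=\sum_{j\in X_i(\alpha)}\alpha_iv_{ij}$. Utility: $u_i=v_i(X_i)-P_i$. The feasible allocations $\mathcal X$ are the profiles $(x_i)_{i\in N}$ of pairwise disjoint subsets of $M$. $\Delta(S)$ denotes probability distributions on $S$. For $A\in\Delta(\mathcal A)$ let $A_{-i}$ be the marginal on the others' actions, and let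 $\mathcal C_i(A_{-i})$ be the set of $A_i'\in\Delta(\mathcal A_i)$ with $\mathbb E_{a_i'\sim A_i',a_{-i}\sim A_{-i}}[P_i(a_i',a_{-i})]\le B_i$ (independent draws). $A\in\Delta(\mathcal A)$ is a coarse correlated equilibrium if for all $i$: $\mathbb E_{a\sim A}[P_i(a)]\le B_i$, and $\mathbb E_{a\sim A}[u_i(a)]\ge\mathbb E_{a_i'\sim A_i',a_{-i}\sim A_{-i}}[u_i(a_i',a_{-i})]$ for all $A_i'\in\mathcal C_i(A_{-i})$. $\mathrm{LW}(I,A)=\sum_i\min\{\mathbb E_{a\sim A}[v_i(X_i(a))],B_i\}$ and $\mathrm{OPT}(I)=\max_{\chi\in\Delta(\mathcal X)}\sum_i\min\{\mathbb E_{x\sim\chi}[v_i(x_i)],B_i\}$. The price of anarchy is the supremum of $\mathrm{OPT}(I)/\mathrm{LW}(I,A)$ over instances $I$ and equilibria $A$. *)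

theory Defs
  imports "HOL-Probability.Probability"
begin

definition lambert_W0 :: "real \<Rightarrow> real" where
  "lambert_W0 x = (THE w. - 1 \<le> w \<and> w * exp w = x)"

lemma lambert_W0_exp_minus_2:
  shows "\<exists>!w::real. - 1 \<le> w \<and> w < 0 \<and> w * exp w = - exp (- 2)"
    and "- 1 \<le> lambert_W0 (- exp (- 2))" "lambert_W0 (- exp (- 2)) < 0"
    and "lambert_W0 (- exp (- 2)) * exp (lambert_W0 (- exp (- 2))) = - exp (- 2)"
proof -
  let ?f = "\<lambda>w::real. w * exp w"
  have mono: "?f x < ?f y" if "- 1 \<le> x" "x < y" for x y
  proof (rule DERIV_pos_imp_increasing_open[OF \<open>x < y\<close>])
    fix z assume "x < z" "z < y"
    have "(?f has_real_derivative (1 + z) * exp z) (at z)"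
      by (auto intro!: derivative_eq_intros simp: algebra_simps)
    moreover have "(1 + z) * exp z > 0"
      using \<open>x < z\<close> that(1) by simp
    ultimately show "\<exists>d. (?f has_real_derivative d) (at z) \<and> 0 < d" by blast
  qed (intro continuous_intros)
  have inj: "x = y" if "- 1 \<le> x" "- 1 \<le> y" "?f x = ?f y" for x y
    using mono[of x y] mono[of y x] that by linarith
  have "\<exists>w\<ge>-1. w \<le> 0 \<and> ?f w = - exp (- 2)"
    by (rule IVT') (auto intro!: continuous_intros)
  then obtain w where w: "- 1 \<le> w" "?f w = - exp (- 2)" by blast
  have neg: "x < 0" if "?f x = - exp (- 2)" for x
  proof (rule ccontr)
    assume "\<not> x < 0"
    then have "0 \<le> ?f x" by simp
    then show False using that by (simp add: not_le)
  qed
  have W: "lambert_W0 (- exp (- 2)) = w"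
    unfolding lambert_W0_def by (rule the_equality) (use w inj in auto)
  show "\<exists>!w::real. - 1 \<le> w \<and> w < 0 \<and> w * exp w = - exp (- 2)"
    using w inj neg[OF w(2)] by metis
  show "- 1 \<le> lambert_W0 (- exp (- 2))" "lambert_W0 (- exp (- 2)) < 0"
    "lambert_W0 (- exp (- 2)) * exp (lambert_W0 (- exp (- 2))) = - exp (- 2)"
    using w neg[OF w(2)] unfolding W by auto
qed

text \<open>
  Bidders are \<open>{..<num_bidders I}\<close>, items are \<open>{..<num_items I}\<close>; values of the
  fields outside these ranges are never consulted. The budget \<open>\<infinity>\<close> means
  "no budget constraint".
\<close>

record auction =
  num_bidders :: nat
  num_items :: nat
  item_val :: "nat \<Rightarrow> nat \<Rightarrow> real"
  budget :: "nat \<Rightarrow> ereal"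
  tie_order :: "nat rel"

definition bidders :: "auction \<Rightarrow> nat set" where
  "bidders I = {..<num_bidders I}"

definition items :: "auction \<Rightarrow> nat set" where
  "items I = {..<num_items I}"

definition valid_auction :: "auction \<Rightarrow> bool" where
  "valid_auction I \<longleftrightarrow>
     2 \<le> num_bidders I \<and> 1 \<le> num_items I \<and>
     (\<forall>i\<in>bidders I. \<forall>j\<in>items I. 0 \<le> item_val I i j) \<and>
     (\<forall>i\<in>bidders I. 0 < budget I i) \<and>
     linear_order_on (bidders I) (tie_order I)"

definition valuation :: "auction \<Rightarrow> nat \<Rightarrow> nat set \<Rightarrow> real" where
  "valuation I i S = (\<Sum>j\<in>S. item_val I i j)"

definition bid :: "auction \<Rightarrow> (nat \<Rightarrow> real) \<Rightarrow> nat \<Rightarrow> nat \<Rightarrow> real" where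
  "bid I \<alpha> i j = \<alpha> i * item_val I i j"

definition highest_bidders :: "auction \<Rightarrow> (nat \<Rightarrow> real) \<Rightarrow> nat \<Rightarrow> nat set" where
  "highest_bidders I \<alpha> j = {i\<in>bidders I. \<forall>k\<in>bidders I. bid I \<alpha> k j \<le> bid I \<alpha> i j}"

text \<open>A pair \<open>(i, k)\<close> in \<open>tie_order I\<close> means that \<open>i\<close> has priority over \<open>k\<close>.\<close>

definition won_items :: "auction \<Rightarrow> nat \<Rightarrow> (nat \<Rightarrow> real) \<Rightarrow> nat set" where
  "won_items I i \<alpha> =
     {j\<in>items I. i \<in> highest_bidders I \<alpha> j \<and>
        (\<forall>k\<in>highest_bidders I \<alpha> j. (i, k) \<in> tie_order I)}"

definition payment :: "auction \<Rightarrow> nat \<Rightarrow> (nat \<Rightarrow> real) \<Rightarrow> real" where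
  "payment I i \<alpha> = (\<Sum>j\<in>won_items I i \<alpha>. bid I \<alpha> i j)"

definition utility :: "auction \<Rightarrow> nat \<Rightarrow> (nat \<Rightarrow> real) \<Rightarrow> real" where
  "utility I i \<alpha> = valuation I i (won_items I i \<alpha>) - payment I i \<alpha>"

definition Delta :: "'a measure \<Rightarrow> 'a measure set" where
  "Delta M = {D. prob_space D \<and> sets D = sets M}"

definition action_space :: "real measure" where
  "action_space = restrict_space borel {0..1}"

definition profile_space :: "auction \<Rightarrow> (nat \<Rightarrow> real) measure" where
  "profile_space I = (\<Pi>\<^sub>M i\<in>bidders I. action_space)"

definition others_space :: "auction \<Rightarrow> nat \<Rightarrow> (nat \<Rightarrow> real) measure" where
  "others_space I i = (\<Pi>\<^sub>M k\<in>bidders I - {i}. action_space)"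

definition others_marginal ::
  "auction \<Rightarrow> nat \<Rightarrow> (nat \<Rightarrow> real) measure \<Rightarrow> (nat \<Rightarrow> real) measure" where
  "others_marginal I i A = distr A (others_space I i) (\<lambda>a. restrict a (bidders I - {i}))"

text \<open>
  Payments, utilities and won values are bounded and Borel measurable in the
  action profile, so the Bochner integrals below are genuine expectations. The
  product measure expresses that the two draws are independent.
\<close>

definition deviation_expectation ::
  "nat \<Rightarrow> real measure \<Rightarrow> (nat \<Rightarrow> real) measure \<Rightarrow> ((nat \<Rightarrow> real) \<Rightarrow> real) \<Rightarrow> real" where
  "deviation_expectation i D R f = (\<integral>(a', a). f (a(i := a')) \<partial>(D \<Otimes>\<^sub>M R))"

definition feasible_deviations ::
  "auction \<Rightarrow> nat \<Rightarrow> (nat \<Rightarrow> real) measure \<Rightarrow> real measure set" where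
  "feasible_deviations I i R =
     {D \<in> Delta action_space. ereal (deviation_expectation i D R (payment I i)) \<le> budget I i}"

definition coarse_correlated_equilibrium ::
  "auction \<Rightarrow> (nat \<Rightarrow> real) measure \<Rightarrow> bool" where
  "coarse_correlated_equilibrium I A \<longleftrightarrow>
     A \<in> Delta (profile_space I) \<and>
     (\<forall>i\<in>bidders I.
        ereal (\<integral>a. payment I i a \<partial>A) \<le> budget I i \<and>
        (\<forall>D \<in> feasible_deviations I i (others_marginal I i A).
           deviation_expectation i D (others_marginal I i A) (utility I i)
             \<le> (\<integral>a. utility I i a \<partial>A)))"

definition liquid_welfare :: "auction \<Rightarrow> (nat \<Rightarrow> real) measure \<Rightarrow> ereal" where
  "liquid_welfare I A =
     (\<Sum>i\<in>bidders I. min (ereal (\<integral>a. valuation I i (won_items I i a) \<partial>A)) (budget I i))"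

definition allocations :: "auction \<Rightarrow> (nat \<Rightarrow> nat set) set" where
  "allocations I = {x \<in> bidders I \<rightarrow>\<^sub>E Pow (items I). disjoint_family_on x (bidders I)}"

text \<open>
  The set of allocations is finite, so its distributions are exactly the
  probability mass functions supported on it, and the supremum is a maximum.
\<close>

definition optimal_liquid_welfare :: "auction \<Rightarrow> ereal" where
  "optimal_liquid_welfare I =
     (SUP D\<in>{D. set_pmf D \<subseteq> allocations I}.
        (\<Sum>i\<in>bidders I.
          min (ereal (measure_pmf.expectation D (\<lambda>x. valuation I i (x i)))) (budget I i)))"

text \<open>
  In \<^typ>\<open>ereal\<close>, \<open>0 / 0 = 0\<close> and \<open>x / 0 = \<infinity>\<close> for \<open>x > 0\<close>; both welfares are
  nonnegative. So an equilibrium with zero welfare on an instance with positive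
  optimum makes the price of anarchy infinite.
\<close>

definition price_of_anarchy :: ereal where
  "price_of_anarchy =
     (SUP (I, A)\<in>{(I, A). valid_auction I \<and> coarse_correlated_equilibrium I A}.
        optimal_liquid_welfare I / liquid_welfare I A)"

end

theory Submission
  imports Defs
begin

text \<open>
  A multiplier \<open>z\<close> earns expected value \<open>V z\<close> at expected price \<open>z V z\<close>. Mixing \<open>z\<close> with the multiplier
  \<open>0\<close> so as to meet the budget shows that the equilibrium utility \<open>u\<^sub>i\<close> is at least
  \<open>(1 - z) min (V z) B\<^sub>i\<close>. The multiplier \<open>z\<close> wins every item whose top bid is below \<open>z v\<^sub>i\<^sub>j\<close>, so
  integrating this bound against \<open>1 / (1 - z)\<close> on \<open>[0, 1 - exp (- t)]\<close>, an interval of mass \<open>t\<close>, gives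
  \<open>t u\<^sub>i \<ge> (1 - exp (- t)) O\<^sub>i - b\<^sub>i\<close>, where \<open>O\<^sub>i\<close> is the truncated value of \<open>i\<close> in the optimum and
  \<open>b\<^sub>i\<close> the expected sum of the top bids on the items that \<open>i\<close> receives there. The \<open>b\<^sub>i\<close> sum up to at
  most the revenue. A bidder whose budget caps the liquid welfare already attains \<open>O\<^sub>i\<close>, but may still pay
  the whole budget; the two cases balance when \<open>t - 1 = 1 - exp (- t)\<close>, that is, for
  \<open>t = 2 + W\<^sub>0 (- exp (- 2))\<close>, which gives the ratio \<open>t / (1 - exp (- t))\<close>.
\<close>

section \<open>Auxiliary facts on orders and integrals\<close>

text \<open>Applied to the set of highest bidders on an item, this produces the bidder whom the tie
  order favours, so every item has a winner.\<close>

lemma linear_order_on_least: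
  assumes "linear_order_on A r" "finite S" "S \<noteq> {}" "S \<subseteq> A"
  shows "\<exists>i\<in>S. \<forall>k\<in>S. (i, k) \<in> r"
  using assms(2-4)
proof (induction S rule: finite_ne_induct)
  case (singleton x)
  then show ?case
    using assms(1) by (auto simp: order_on_defs refl_on_def)
next
  case (insert x S)
  then obtain i where i: "i \<in> S" "\<forall>k\<in>S. (i, k) \<in> r" by auto
  have refl: "(x, x) \<in> r" and tr: "trans r" and tot: "(i, x) \<in> r \<or> (x, i) \<in> r"
    using assms(1) insert i by (auto simp: order_on_defs refl_on_def total_on_def)
  show ?case
    using tot i refl by (auto dest: transD[OF tr])
qed

text \<open>For \<open>m < \<kappa> * w\<close> the integrand equals \<open>p * w\<close> exactly on
  the interval from \<open>m / w\<close> to \<open>\<kappa>\<close>, which gives equality; otherwise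
  the left side is at most 0. In the application \<open>m\<close> is the top bid on an item,
  \<open>w\<close> the bidder's value for it and \<open>p\<close> the probability of receiving it in
  the optimum.\<close>

lemma integral_above_threshold:
  fixes \<kappa> m p w :: real
  assumes "0 \<le> m" "0 \<le> p" "0 \<le> w"
  shows "p * (\<kappa> * w - m)
    \<le> (\<integral>z. (if m < z * w then p * w else 0) \<partial>restrict_space lborel {0..\<kappa>})"
proof (cases "m < \<kappa> * w")
  case True
  then have w: "0 < w" using assms by (cases "w = 0") auto
  have mw: "0 \<le> m / w" "m / w \<le> \<kappa>" using True assms w by (auto simp: field_simps)
  have "indicator {0..\<kappa>} z *\<^sub>R (if m < z * w then p * w else 0)
      = indicator {m / w<..\<kappa>} z * (p * w)" for z
  proof (cases "m < z * w")
    case True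
    then have "0 \<le> z" using assms w by (smt (verit) mult_nonpos_nonneg)
    moreover have "m / w < z" using True w by (simp add: pos_divide_less_eq)
    ultimately show ?thesis using True by (simp add: indicator_def)
  next
    case False
    then show ?thesis using w by (simp add: indicator_def pos_divide_less_eq)
  qed
  then have "(\<integral>z. (if m < z * w then p * w else 0) \<partial>restrict_space lborel {0..\<kappa>})
      = (\<integral>z. indicator {m / w<..\<kappa>} z * (p * w) \<partial>lborel)"
    by (subst integral_restrict_space) simp_all
  also have "\<dots> = (\<kappa> - m / w) * (p * w)" using mw by simp
  also have "\<dots> = p * (\<kappa> * w - m)" using w by (simp add: field_simps)
  finally show ?thesis by simp
next
  case False
  then have "p * (\<kappa> * w - m) \<le> 0" using assms by (simp add: mult_nonneg_nonpos)
  also have "0 \<le> (\<integral>z. (if m < z * w then p * w else 0) \<partial>restrict_space lborel {0..\<kappa>})"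
    using assms by (intro integral_nonneg_AE) auto
  finally show ?thesis .
qed

section \<open>Winners, payments and top bids for a fixed profile\<close>

text \<open>The maximum includes the current bid of the bidder whose deviation is studied. It is
  thus the same threshold for all bidders, and it can be charged to the revenue.\<close>

definition top_bid :: "auction \<Rightarrow> nat \<Rightarrow> (nat \<Rightarrow> real) \<Rightarrow> real" where
  "top_bid I j a = Max ((\<lambda>k. bid I a k j) ` bidders I)"

abbreviation won_value :: "auction \<Rightarrow> nat \<Rightarrow> (nat \<Rightarrow> real) \<Rightarrow> real" where
  "won_value I i a \<equiv> valuation I i (won_items I i a)"

locale auction_instance =
  fixes I :: auction
  assumes valid: "valid_auction I"
begin

lemma finite_bidders [simp]: "finite (bidders I)"
  by (simp add: bidders_def)

lemma finite_items [simp]: "finite (items I)"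
  by (simp add: items_def)

lemma bidders_nonempty: "bidders I \<noteq> {}"
  using valid by (auto simp: valid_auction_def bidders_def lessThan_empty_iff)

lemma item_val_nonneg: "i \<in> bidders I \<Longrightarrow> j \<in> items I \<Longrightarrow> 0 \<le> item_val I i j"
  using valid by (auto simp: valid_auction_def)

lemma budget_pos: "i \<in> bidders I \<Longrightarrow> 0 < budget I i"
  using valid by (auto simp: valid_auction_def)

lemma tie_order: "linear_order_on (bidders I) (tie_order I)"
  using valid by (auto simp: valid_auction_def)

lemma won_items_subset: "won_items I i a \<subseteq> items I"
  by (auto simp: won_items_def)

lemma finite_won_items [simp]: "finite (won_items I i a)"
  using won_items_subset finite_items by (rule finite_subset)

lemma won_value_eq_sum:
  "won_value I i a = (\<Sum>j\<in>items I. if j \<in> won_items I i a then item_val I i j else 0)"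
  unfolding valuation_def using won_items_subset
  by (simp add: sum.If_cases Int_absorb1)

lemma payment_eq: "payment I i a = a i * won_value I i a"
  by (simp add: payment_def valuation_def bid_def sum_distrib_left)

lemma utility_eq: "utility I i a = (1 - a i) * won_value I i a"
  by (simp add: utility_def payment_eq algebra_simps)

lemma won_value_nonneg: "i \<in> bidders I \<Longrightarrow> 0 \<le> won_value I i a"
  unfolding valuation_def by (intro sum_nonneg) (auto simp: won_items_def item_val_nonneg)

lemma won_value_le: "i \<in> bidders I \<Longrightarrow> won_value I i a \<le> valuation I i (items I)"
  unfolding valuation_def
  by (intro sum_mono2) (auto simp: won_items_def item_val_nonneg)

lemma bid_le_top_bid: "k \<in> bidders I \<Longrightarrow> bid I a k j \<le> top_bid I j a"
  by (simp add: top_bid_def)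

text \<open>In a first-price auction the winner of an item pays the top bid on it. Since multipliers
  are nonnegative, the other summands cannot lower the total.\<close>

lemma top_bid_le_payments:
  "(\<Sum>j\<in>items I. top_bid I j a) \<le> (\<Sum>i\<in>bidders I. payment I i a)"
  if nonneg: "\<And>i. i \<in> bidders I \<Longrightarrow> 0 \<le> a i"
proof -
  have "top_bid I j a \<le> (\<Sum>i\<in>bidders I. if j \<in> won_items I i a then bid I a i j else 0)"
    if j: "j \<in> items I" for j
  proof -
    have "highest_bidders I a j \<noteq> {}"
    proof -
      have "top_bid I j a \<in> (\<lambda>k. bid I a k j) ` bidders I"
        unfolding top_bid_def using bidders_nonempty by (intro Max_in) auto
      then obtain k where "k \<in> bidders I" "bid I a k j = top_bid I j a" by auto
      then have "k \<in> highest_bidders I a j"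
        by (auto simp: highest_bidders_def bid_le_top_bid)
      then show ?thesis by blast
    qed
    moreover have sub: "highest_bidders I a j \<subseteq> bidders I"
      by (auto simp: highest_bidders_def)
    ultimately obtain i where i: "i \<in> highest_bidders I a j"
      "\<forall>k\<in>highest_bidders I a j. (i, k) \<in> tie_order I"
      using linear_order_on_least[OF tie_order] finite_subset[OF sub finite_bidders] by metis
    then have win: "j \<in> won_items I i a" and ib: "i \<in> bidders I"
      using j sub by (auto simp: won_items_def)
    have "top_bid I j a \<le> bid I a i j"
      unfolding top_bid_def using i(1) bidders_nonempty
      by (auto simp: highest_bidders_def)
    also have "\<dots> = (if j \<in> won_items I i a then bid I a i j else 0)" using win by simp
    also have "\<dots> \<le> (\<Sum>i\<in>bidders I. if j \<in> won_items I i a then bid I a i j else 0)"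
      using ib j nonneg item_val_nonneg by (intro member_le_sum) (auto simp: bid_def)
    finally show ?thesis .
  qed
  then have "(\<Sum>j\<in>items I. top_bid I j a)
      \<le> (\<Sum>j\<in>items I. \<Sum>i\<in>bidders I. if j \<in> won_items I i a then bid I a i j else 0)"
    by (intro sum_mono)
  also have "\<dots> = (\<Sum>i\<in>bidders I. \<Sum>j\<in>items I. if j \<in> won_items I i a then bid I a i j else 0)"
    by (rule sum.swap)
  also have "\<dots> = (\<Sum>i\<in>bidders I. payment I i a)"
    unfolding payment_def using won_items_subset by (simp add: sum.If_cases Int_absorb1)
  finally show ?thesis .
qed

text \<open>The bids of the others are unchanged and at most the old top bid, so the deviator
  becomes the unique highest bidder and no tie arises.\<close>

lemma win_above_top_bid:
  assumes i: "i \<in> bidders I" and j: "j \<in> items I"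
    and above: "top_bid I j a < z * item_val I i j"
  shows "j \<in> won_items I i (a(i := z))"
proof -
  have "bid I (a(i := z)) k j < bid I (a(i := z)) i j" if "k \<in> bidders I" "k \<noteq> i" for k
    using bid_le_top_bid[OF that(1), of a j] above that(2) by (simp add: bid_def)
  then have "highest_bidders I (a(i := z)) j = {i}"
    unfolding highest_bidders_def using i by (force intro: less_imp_le)
  moreover have "(i, i) \<in> tie_order I"
    using tie_order i by (auto simp: order_on_defs refl_on_def)
  ultimately show ?thesis
    using j by (simp add: won_items_def)
qed

section \<open>Measurability and bounds in the action profile\<close>

lemma component_in_unit:
  assumes "a \<in> space (profile_space I)" "k \<in> bidders I"
  shows "0 \<le> a k" "a k \<le> 1"
  using assms by (auto simp: profile_space_def action_space_def space_PiM space_restrict_space PiE_iff)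

lemma measurable_component [measurable]:
  assumes "k \<in> bidders I"
  shows "(\<lambda>a. a k) \<in> borel_measurable (profile_space I)"
proof -
  have "(\<lambda>a. a k) \<in> measurable (profile_space I) action_space"
    unfolding profile_space_def using assms by (rule measurable_component_singleton)
  moreover have "(\<lambda>x. x) \<in> borel_measurable action_space"
    unfolding action_space_def by (rule measurable_restrict_space1) simp
  ultimately show ?thesis
    using measurable_compose by blast
qed

lemma measurable_highest [measurable]:
  "Measurable.pred (profile_space I) (\<lambda>a. i \<in> highest_bidders I a j)"
proof (cases "i \<in> bidders I")
  case True
  have "Measurable.pred (profile_space I)
      (\<lambda>a. \<forall>k\<in>bidders I. a k * item_val I k j \<le> a i * item_val I i j)"
  proof (intro pred_intros_finite)
    fix k assume "k \<in> bidders I"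
    then show "Measurable.pred (profile_space I)
        (\<lambda>a. a k * item_val I k j \<le> a i * item_val I i j)"
      unfolding pred_def using True
      by (intro borel_measurable_le borel_measurable_times measurable_component
          borel_measurable_const)
  qed simp
  then show ?thesis
    using True by (simp add: highest_bidders_def bid_def)
qed (simp add: highest_bidders_def)

lemma measurable_won [measurable]:
  "Measurable.pred (profile_space I) (\<lambda>a. j \<in> won_items I i a)"
proof -
  \<comment> \<open>The quantifier over \<open>highest_bidders I a j\<close>, a set that varies with
    \<open>a\<close>, is moved to the fixed finite set \<open>bidders I\<close>, where finite
    conjunctions preserve measurability.\<close>
  have "(j \<in> won_items I i a) \<longleftrightarrow> j \<in> items I \<and> i \<in> highest_bidders I a j \<and>
      (\<forall>k\<in>bidders I. k \<in> highest_bidders I a j \<longrightarrow> (i, k) \<in> tie_order I)" for a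
    by (auto simp: won_items_def highest_bidders_def)
  moreover have "Measurable.pred (profile_space I) (\<lambda>a. j \<in> items I \<and> i \<in> highest_bidders I a j \<and>
      (\<forall>k\<in>bidders I. k \<in> highest_bidders I a j \<longrightarrow> (i, k) \<in> tie_order I))"
    by measurable
  ultimately show ?thesis by simp
qed

lemma measurable_won_value [measurable]: "won_value I i \<in> borel_measurable (profile_space I)"
  unfolding won_value_eq_sum by measurable

lemma measurable_payment [measurable]:
  "i \<in> bidders I \<Longrightarrow> payment I i \<in> borel_measurable (profile_space I)"
  unfolding payment_eq by measurable

lemma measurable_utility [measurable]:
  "i \<in> bidders I \<Longrightarrow> utility I i \<in> borel_measurable (profile_space I)"
  unfolding utility_eq by measurable

lemma measurable_top_bid [measurable]: "top_bid I j \<in> borel_measurable (profile_space I)"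
proof -
  have "(\<lambda>a. Max ((\<lambda>k. a k * item_val I k j) ` bidders I)) \<in> borel_measurable (profile_space I)"
    by (intro borel_measurable_Max) auto
  then show ?thesis
    by (simp add: top_bid_def[abs_def] bid_def)
qed

lemma measurable_deviate:
  assumes "i \<in> bidders I"
  shows "(\<lambda>(z, a). a(i := z)) \<in> measurable (action_space \<Otimes>\<^sub>M others_space I i) (profile_space I)"
  unfolding profile_space_def others_space_def case_prod_beta
  using assms by (intro measurable_fun_upd[where J = "bidders I - {i}"]) auto

lemma measurable_restrict_others:
  "(\<lambda>a. restrict a (bidders I - {i})) \<in> measurable (profile_space I) (others_space I i)"
  unfolding profile_space_def others_space_def by (rule measurable_restrict_subset) auto

text \<open>Profiles are total functions on the naturals, of which only the bidders' components are
  consulted. This allows a profile to be restricted to the other bidders and then completed by a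
  deviation.\<close>

lemma won_value_cong:
  assumes "\<And>k. k \<in> bidders I \<Longrightarrow> a k = b k"
  shows "won_value I i a = won_value I i b"
proof -
  have "highest_bidders I a j = highest_bidders I b j" for j
    using assms by (auto simp: highest_bidders_def bid_def)
  then show ?thesis by (simp add: won_items_def)
qed

lemma top_bid_bounds:
  assumes "a \<in> space (profile_space I)" "j \<in> items I"
  shows "0 \<le> top_bid I j a" "top_bid I j a \<le> (\<Sum>k\<in>bidders I. item_val I k j)"
proof -
  obtain k where k: "k \<in> bidders I" using bidders_nonempty by blast
  have "0 \<le> bid I a k j"
    using component_in_unit[OF assms(1) k] item_val_nonneg[OF k assms(2)] by (simp add: bid_def)
  then show "0 \<le> top_bid I j a" using bid_le_top_bid[OF k, of a j] by linarith
  have "bid I a k j \<le> (\<Sum>k\<in>bidders I. item_val I k j)" if "k \<in> bidders I" for k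
  proof -
    have "bid I a k j \<le> item_val I k j"
      using component_in_unit[OF assms(1) that] item_val_nonneg[OF that assms(2)]
      by (simp add: bid_def mult_left_le_one_le)
    also have "\<dots> \<le> (\<Sum>k\<in>bidders I. item_val I k j)"
      using that item_val_nonneg assms(2) by (intro member_le_sum) auto
    finally show ?thesis .
  qed
  then show "top_bid I j a \<le> (\<Sum>k\<in>bidders I. item_val I k j)"
    unfolding top_bid_def using bidders_nonempty by auto
qed

end

section \<open>Expectations under an equilibrium\<close>

locale auction_equilibrium = auction_instance +
  fixes A :: "(nat \<Rightarrow> real) measure"
  assumes eq: "coarse_correlated_equilibrium I A"
begin

lemma sets_A [measurable_cong]: "sets A = sets (profile_space I)"
  using eq by (simp add: coarse_correlated_equilibrium_def Delta_def)

lemma space_A: "space A = space (profile_space I)"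
  using sets_A by (rule sets_eq_imp_space_eq)

sublocale prob_space A
  using eq by (simp add: coarse_correlated_equilibrium_def Delta_def)

lemma integrable_bounded:
  fixes f :: "_ \<Rightarrow> real"
  assumes "f \<in> borel_measurable (profile_space I)"
    "\<And>a. a \<in> space (profile_space I) \<Longrightarrow> \<bar>f a\<bar> \<le> C"
  shows "integrable A f"
proof (rule integrable_const_bound[where B = C])
  show "f \<in> borel_measurable A" using assms(1) by measurable
  show "AE a in A. norm (f a) \<le> C" using assms(2) by (auto simp: space_A)
qed

lemma
  assumes "i \<in> bidders I"
  shows integrable_won_value: "integrable A (won_value I i)"
    and integrable_payment: "integrable A (payment I i)"
proof -
  have b: "\<bar>won_value I i a\<bar> \<le> valuation I i (items I)" for a
    using won_value_nonneg won_value_le assms by (simp add: abs_le_iff le_diff_eq)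
  then show "integrable A (won_value I i)"
    by (intro integrable_bounded) measurable
  show "integrable A (payment I i)"
  proof (rule integrable_bounded)
    fix a assume "a \<in> space (profile_space I)"
    then have "\<bar>payment I i a\<bar> \<le> 1 * valuation I i (items I)"
      unfolding payment_eq abs_mult using component_in_unit[OF _ assms] b
      by (intro mult_mono) auto
    then show "\<bar>payment I i a\<bar> \<le> valuation I i (items I)" by simp
  qed (use assms in measurable)
qed

lemma integrable_top_bid: "j \<in> items I \<Longrightarrow> integrable A (top_bid I j)"
  by (rule integrable_bounded[where C = "\<Sum>k\<in>bidders I. item_val I k j"])
    (use top_bid_bounds in auto)

section \<open>Deviations that meet the budget by randomization\<close>

text \<open>The multiplier 0 pays nothing, so playing \<open>z\<close> only with probability
  \<open>q\<close> scales the expected payment by \<open>q\<close>. This is how a multiplier that is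
  too expensive becomes budget feasible.\<close>

definition mixed_deviation :: "real \<Rightarrow> real \<Rightarrow> real measure" where
  "mixed_deviation q z =
     distr (measure_pmf (bernoulli_pmf q)) action_space (\<lambda>b. if b then z else 0)"

lemma mixed_deviation_Delta:
  assumes "0 \<le> z" "z \<le> 1"
  shows "mixed_deviation q z \<in> Delta action_space"
proof -
  have "(\<lambda>b. if b then z else 0) \<in> measurable (measure_pmf (bernoulli_pmf q)) action_space"
    using assms by (auto simp: action_space_def space_restrict_space)
  then show ?thesis
    by (simp add: Delta_def mixed_deviation_def measure_pmf.prob_space_distr)
qed

text \<open>Fubini separates the two independent draws; the deviator's own draw has two outcomes.
  The bound \<open>C\<close> provides integrability, and \<open>cong\<close> allows the marginal on
  the others to be replaced by \<open>A\<close>.\<close>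

lemma deviation_expectation_mixed:
  fixes f :: "(nat \<Rightarrow> real) \<Rightarrow> real"
  assumes i: "i \<in> bidders I" and z: "0 \<le> z" "z \<le> 1" and q: "0 \<le> q" "q \<le> 1"
    and f [measurable]: "f \<in> borel_measurable (profile_space I)"
    and bound: "\<And>a. a \<in> space (profile_space I) \<Longrightarrow> \<bar>f a\<bar> \<le> C"
    and cong: "\<And>a b. (\<And>k. k \<in> bidders I \<Longrightarrow> a k = b k) \<Longrightarrow> f a = f b"
  shows "deviation_expectation i (mixed_deviation q z) (others_marginal I i A) f
     = q * (\<integral>a. f (a(i := z)) \<partial>A) + (1 - q) * (\<integral>a. f (a(i := 0)) \<partial>A)"
proof -
  define D where "D = mixed_deviation q z"
  define R where "R = others_marginal I i A"
  have ms: "(\<lambda>b. if b then z else 0) \<in> measurable (measure_pmf (bernoulli_pmf q)) action_space"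
    using z by (auto simp: action_space_def space_restrict_space)
  have mr: "(\<lambda>a. restrict a (bidders I - {i})) \<in> measurable A (others_space I i)"
    using measurable_restrict_others measurable_cong_sets[OF sets_A refl] by blast
  interpret D: prob_space D
    using mixed_deviation_Delta[OF z] by (simp add: D_def Delta_def)
  interpret R: prob_space R
    unfolding R_def others_marginal_def using mr by (rule prob_space_distr)
  interpret DR: pair_prob_space D R ..
  have sD: "sets D = sets action_space" by (simp add: D_def mixed_deviation_def)
  have sR: "sets R = sets (others_space I i)" by (simp add: R_def others_marginal_def)
  have sDR: "sets (D \<Otimes>\<^sub>M R) = sets (action_space \<Otimes>\<^sub>M others_space I i)"
    using sD sR by (rule sets_pair_measure_cong)
  have md: "(\<lambda>(z, a). a(i := z)) \<in> measurable (D \<Otimes>\<^sub>M R) (profile_space I)"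
    using measurable_deviate[OF i] measurable_cong_sets[OF sDR refl] by blast
  have mf: "(\<lambda>(z, a). f (a(i := z))) \<in> borel_measurable (action_space \<Otimes>\<^sub>M others_space I i)"
    using measurable_compose[OF measurable_deviate[OF i] f] by (simp add: case_prod_beta)
  have mf': "(\<lambda>(z, a). f (a(i := z))) \<in> borel_measurable (D \<Otimes>\<^sub>M R)"
    using mf measurable_cong_sets[OF sDR refl] by blast
  have int: "integrable (D \<Otimes>\<^sub>M R) (\<lambda>(z, a). f (a(i := z)))"
  proof (rule DR.integrable_const_bound[where B = C])
    show "AE x in D \<Otimes>\<^sub>M R. norm (case x of (z, a) \<Rightarrow> f (a(i := z))) \<le> C"
    proof (rule AE_I2)
      fix x assume "x \<in> space (D \<Otimes>\<^sub>M R)"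
      then have "(case x of (z, a) \<Rightarrow> a(i := z)) \<in> space (profile_space I)"
        by (rule measurable_space[OF md])
      then show "norm (case x of (z, a) \<Rightarrow> f (a(i := z))) \<le> C"
        using bound by (auto simp: case_prod_beta)
    qed
  qed (rule mf')
  \<comment> \<open>Component \<open>i\<close> is overwritten in any case, so restricting to the
    others does not change the value of \<open>f\<close>.\<close>
  have inner: "(\<integral>a. f (a(i := y)) \<partial>R) = (\<integral>a. f (a(i := y)) \<partial>A)" if y: "y \<in> space action_space" for y
  proof -
    have "(\<lambda>a. f (a(i := y))) \<in> borel_measurable (others_space I i)"
      using measurable_compose[OF measurable_Pair1'[OF y] mf] by simp
    then have "(\<integral>a. f (a(i := y)) \<partial>R) = (\<integral>a. f ((restrict a (bidders I - {i}))(i := y)) \<partial>A)"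
      unfolding R_def others_marginal_def using mr by (intro integral_distr)
    also have "\<dots> = (\<integral>a. f (a(i := y)) \<partial>A)"
      by (intro Bochner_Integration.integral_cong refl cong) auto
    finally show ?thesis .
  qed
  have "deviation_expectation i D R f = (\<integral>y. (\<integral>a. f (a(i := y)) \<partial>R) \<partial>D)"
    unfolding deviation_expectation_def by (rule DR.integral_fst[symmetric, OF int])
  also have "\<dots> = (\<integral>b. (\<integral>a. f (a(i := (if b then z else 0))) \<partial>R) \<partial>measure_pmf (bernoulli_pmf q))"
    unfolding D_def mixed_deviation_def
  proof (rule integral_distr[OF ms])
    have "(\<lambda>y. \<integral>a. f (a(i := y)) \<partial>R) \<in> borel_measurable D"
      using R.borel_measurable_lebesgue_integral[OF mf'] .
    then show "(\<lambda>y. \<integral>a. f (a(i := y)) \<partial>R) \<in> borel_measurable action_space"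
      using measurable_cong_sets[OF sD refl] by blast
  qed
  also have "\<dots> = q * (\<integral>a. f (a(i := z)) \<partial>R) + (1 - q) * (\<integral>a. f (a(i := 0)) \<partial>R)"
    using q by (simp add: mult.commute)
  also have "\<dots> = q * (\<integral>a. f (a(i := z)) \<partial>A) + (1 - q) * (\<integral>a. f (a(i := 0)) \<partial>A)"
    using z by (simp add: inner action_space_def space_restrict_space)
  finally show ?thesis by (simp add: D_def R_def)
qed

text \<open>Deviate to \<open>z\<close> with probability \<open>y / V\<close>, where
  \<open>V\<close> is the expected value won with \<open>z\<close>. The expected payment is then
  \<open>z * y\<close>, within the budget, and the part played at \<open>z\<close> contributes
  utility \<open>(1 - z) * y\<close>.\<close>

lemma deviation_bound:
  assumes i: "i \<in> bidders I" and z: "0 \<le> z" "z \<le> 1"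
    and y: "0 \<le> y" "y \<le> (\<integral>a. won_value I i (a(i := z)) \<partial>A)" "ereal y \<le> budget I i"
  shows "(1 - z) * y \<le> (\<integral>a. utility I i a \<partial>A)"
proof -
  let ?V = "\<lambda>z. \<integral>a. won_value I i (a(i := z)) \<partial>A"
  have V_nonneg: "0 \<le> ?V z" for z
    using won_value_nonneg[OF i] by (intro integral_nonneg_AE) auto
  have unit: "\<bar>c * won_value I i a\<bar> \<le> valuation I i (items I)" if "0 \<le> c" "c \<le> 1" for c a
    using that won_value_nonneg[OF i, of a] won_value_le[OF i, of a]
    by (simp add: abs_mult order_trans[OF mult_left_le_one_le])
  have dev_pay: "deviation_expectation i (mixed_deviation q z) (others_marginal I i A) (payment I i)
      = q * (z * ?V z)" if "0 \<le> q" "q \<le> 1" for q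
  proof -
    have "deviation_expectation i (mixed_deviation q z) (others_marginal I i A) (payment I i)
      = q * (\<integral>a. payment I i (a(i := z)) \<partial>A) + (1 - q) * (\<integral>a. payment I i (a(i := 0)) \<partial>A)"
    proof (rule deviation_expectation_mixed[OF i z that measurable_payment[OF i]])
      fix a assume "a \<in> space (profile_space I)"
      then show "\<bar>payment I i a\<bar> \<le> valuation I i (items I)"
        unfolding payment_eq using component_in_unit i by (intro unit) auto
    next
      fix a b :: "nat \<Rightarrow> real"
      assume "\<And>k. k \<in> bidders I \<Longrightarrow> a k = b k"
      then have "won_value I i a = won_value I i b" "a i = b i"
        using i by (auto intro: won_value_cong)
      then show "payment I i a = payment I i b" by (simp add: payment_eq)
    qed
    then show ?thesis by (simp add: payment_eq)
  qed
  have dev_ut: "q * ((1 - z) * ?V z) \<le>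
      deviation_expectation i (mixed_deviation q z) (others_marginal I i A) (utility I i)"
    if "0 \<le> q" "q \<le> 1" for q
  proof -
    have "deviation_expectation i (mixed_deviation q z) (others_marginal I i A) (utility I i)
      = q * (\<integral>a. utility I i (a(i := z)) \<partial>A) + (1 - q) * (\<integral>a. utility I i (a(i := 0)) \<partial>A)"
    proof (rule deviation_expectation_mixed[OF i z that measurable_utility[OF i]])
      fix a assume "a \<in> space (profile_space I)"
      then show "\<bar>utility I i a\<bar> \<le> valuation I i (items I)"
        unfolding utility_eq using component_in_unit i by (intro unit) auto
    next
      fix a b :: "nat \<Rightarrow> real"
      assume "\<And>k. k \<in> bidders I \<Longrightarrow> a k = b k"
      then have "won_value I i a = won_value I i b" "a i = b i"
        using i by (auto intro: won_value_cong)
      then show "utility I i a = utility I i b" by (simp add: utility_eq)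
    qed
    then have "deviation_expectation i (mixed_deviation q z) (others_marginal I i A) (utility I i)
      = q * ((1 - z) * ?V z) + (1 - q) * ?V 0"
      by (simp add: utility_eq)
    then show ?thesis using V_nonneg[of 0] that by simp
  qed
  have key: "q * ((1 - z) * ?V z) \<le> (\<integral>a. utility I i a \<partial>A)"
    if q: "0 \<le> q" "q \<le> 1" and feas: "ereal (q * (z * ?V z)) \<le> budget I i" for q
  proof -
    have "mixed_deviation q z \<in> feasible_deviations I i (others_marginal I i A)"
      using feas dev_pay[OF q] mixed_deviation_Delta[OF z] by (simp add: feasible_deviations_def)
    then have "deviation_expectation i (mixed_deviation q z) (others_marginal I i A) (utility I i)
        \<le> (\<integral>a. utility I i a \<partial>A)"
      using eq i by (simp add: coarse_correlated_equilibrium_def)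
    with dev_ut[OF q] show ?thesis by linarith
  qed
  show ?thesis
  proof (cases "?V z = 0")
    case True
    \<comment> \<open>Here \<open>y / V\<close> is meaningless. Playing 0 throughout is feasible
      because budgets are positive, and shows that the equilibrium utility is nonnegative.\<close>
    then have "y = 0" using y by simp
    moreover have "0 \<le> (\<integral>a. utility I i a \<partial>A)"
      using key[of 0] budget_pos[OF i] by (simp add: less_imp_le zero_ereal_def[symmetric])
    ultimately show ?thesis by simp
  next
    case False
    define q where "q = y / ?V z"
    have V: "0 < ?V z" using V_nonneg[of z] False by simp
    have qV: "q * ?V z = y" using V by (simp add: q_def)
    have "z * y \<le> y" using y(1) z by (simp add: mult_left_le_one_le)
    then have "ereal (q * (z * ?V z)) \<le> budget I i"
      using y(3) qV by (metis ereal_less_eq(3) mult.left_commute order_trans)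
    moreover have "0 \<le> q" "q \<le> 1" using y V by (auto simp: q_def)
    ultimately have "q * ((1 - z) * ?V z) \<le> (\<integral>a. utility I i a \<partial>A)" by (intro key)
    then show ?thesis using qV by (metis mult.left_commute)
  qed
qed

section \<open>The smoothness inequality for one bidder\<close>

text \<open>The deviation bound is averaged over multipliers \<open>z\<close> with density
  \<open>1 / (1 - z)\<close>, which cancels the factor \<open>1 - z\<close>. Here
  \<open>\<pi> j\<close> stands for the probability that the optimum gives item \<open>j\<close> to
  bidder \<open>i\<close>, and \<open>O'\<close> for the resulting value after truncation at the
  budget.\<close>

lemma utility_smoothness:
  fixes \<pi> :: "nat \<Rightarrow> real" and O' t :: real
  assumes i: "i \<in> bidders I" and t: "0 \<le> t"
    and \<pi>: "\<And>j. j \<in> items I \<Longrightarrow> 0 \<le> \<pi> j" "\<And>j. j \<in> items I \<Longrightarrow> \<pi> j \<le> 1"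
    and O: "0 \<le> O'" "O' \<le> (\<Sum>j\<in>items I. \<pi> j * item_val I i j)" "ereal O' \<le> budget I i"
  shows "(1 - exp (- t)) * O' - (\<Sum>j\<in>items I. \<pi> j * (\<integral>a. top_bid I j a \<partial>A))
    \<le> t * (\<integral>a. utility I i a \<partial>A)"
proof -
  define \<kappa> where "\<kappa> = 1 - exp (- t)"
  define u where "u = (\<integral>a. utility I i a \<partial>A)"
  define v where "v = (\<Sum>j\<in>items I. \<pi> j * item_val I i j)"
  define b where "b = (\<Sum>j\<in>items I. \<pi> j * (\<integral>a. top_bid I j a \<partial>A))"
  define N :: "real measure" where "N = restrict_space lborel {0..\<kappa>}"
  \<comment> \<open>A lower bound on the value won with \<open>z\<close>: only items whose top bid
    is strictly beaten count, each weighted by \<open>\<pi> j\<close>. The weights keep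
    \<open>h\<close> below \<open>v\<close>, which the budget argument requires.\<close>
  define h where "h z a = (\<Sum>j\<in>items I. if top_bid I j a < z * item_val I i j
    then \<pi> j * item_val I i j else 0)" for z a
  have \<kappa>: "0 \<le> \<kappa>" "\<kappa> < 1" using t by (auto simp: \<kappa>_def)
  have v: "0 \<le> v" unfolding v_def using \<pi> item_val_nonneg i by (intro sum_nonneg) auto
  have b: "0 \<le> b"
    unfolding b_def using \<pi> top_bid_bounds space_A
    by (intro sum_nonneg mult_nonneg_nonneg integral_nonneg_AE AE_I2) auto
  have u: "0 \<le> u"
    using deviation_bound[OF i, of 0 0] won_value_nonneg[OF i] budget_pos[OF i]
    by (simp add: u_def less_imp_le zero_ereal_def[symmetric] integral_nonneg_AE)
  show ?thesis
  proof (cases "v = 0")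
    case True
    then have "O' = 0" using O by (simp add: v_def)
    moreover have "0 \<le> t * u" using u t by simp
    ultimately show ?thesis using b by (simp add: b_def u_def)
  next
    case False
    then have v: "0 < v" using v by simp
    have h_nonneg: "0 \<le> h z a" for z a
      unfolding h_def using \<pi> item_val_nonneg i by (intro sum_nonneg) auto
    have h_le: "h z a \<le> v" for z a
      unfolding h_def v_def using \<pi> item_val_nonneg i by (intro sum_mono) auto
    have h_won: "h z a \<le> won_value I i (a(i := z))" for z a
      unfolding h_def won_value_eq_sum
      using \<pi> item_val_nonneg[OF i] win_above_top_bid[OF i]
      by (intro sum_mono) (auto intro: mult_left_le_one_le)
    have [measurable_cong]: "sets N = sets (restrict_space borel {0..\<kappa>})"
      by (simp add: N_def sets_restrict_space)
    have [measurable]: "(\<lambda>z. z) \<in> borel_measurable N"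
      unfolding N_def by (intro measurable_restrict_space1) simp
    interpret N: finite_measure N
      using \<kappa> by (intro finite_measureI) (simp add: N_def emeasure_restrict_space space_restrict_space)
    interpret NA: pair_sigma_finite N A ..
    have mh: "(\<lambda>(z, a). h z a) \<in> borel_measurable (N \<Otimes>\<^sub>M A)"
      unfolding h_def by measurable
    have int_h: "integrable (N \<Otimes>\<^sub>M A) (\<lambda>(z, a). h z a)"
    proof (rule finite_measure.integrable_const_bound[where B = v])
      show "finite_measure (N \<Otimes>\<^sub>M A)"
        by (intro finite_measure_pair_measure N.finite_measure_axioms finite_measure_axioms)
    qed (use mh h_nonneg h_le in auto)
    have pointwise: "O' / v * (\<integral>a. h z a \<partial>A) \<le> u / (1 - z)" if z: "z \<in> {0..\<kappa>}" for z
    proof -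
      have mhz: "(\<lambda>a. h z a) \<in> borel_measurable A"
        unfolding h_def by measurable
      have ih: "integrable A (h z)"
        using mhz h_nonneg h_le by (intro integrable_const_bound[where B = v]) auto
      have upd: "(\<lambda>a. won_value I i (a(i := z))) \<in> borel_measurable (profile_space I)"
      proof (rule measurable_compose[OF _ measurable_won_value])
        have "(\<lambda>a. z) \<in> measurable (profile_space I) action_space"
          using z \<kappa> by (simp add: action_space_def space_restrict_space)
        then show "(\<lambda>a. a(i := z)) \<in> measurable (profile_space I) (profile_space I)"
          unfolding profile_space_def using i
          by (intro measurable_fun_upd[where J = "bidders I"]) auto
      qed
      have iw: "integrable A (\<lambda>a. won_value I i (a(i := z)))"
        using upd won_value_nonneg[OF i] won_value_le[OF i]
        by (intro integrable_bounded[where C = "valuation I i (items I)"]) auto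
      have H: "0 \<le> (\<integral>a. h z a \<partial>A)" "(\<integral>a. h z a \<partial>A) \<le> v"
        using h_nonneg h_le integral_le_const[OF ih] by (auto intro!: integral_nonneg_AE)
      \<comment> \<open>Scaling by \<open>O' / v\<close> serves both conditions of the deviation
        bound: the factor is at most 1, so \<open>y\<close> stays below the value won, and
        \<open>h\<close> is at most \<open>v\<close>, so \<open>y\<close> is at most
        \<open>O'\<close> and hence at most the budget.\<close>
      define y where "y = O' / v * (\<integral>a. h z a \<partial>A)"
      have y0: "0 \<le> y" using H O v by (simp add: y_def)
      have "y \<le> 1 * (\<integral>a. h z a \<partial>A)"
        unfolding y_def using O v H by (intro mult_right_mono) (auto simp: v_def)
      also have "\<dots> \<le> (\<integral>a. won_value I i (a(i := z)) \<partial>A)"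
        using h_won by (simp add: integral_mono[OF ih iw])
      finally have yV: "y \<le> (\<integral>a. won_value I i (a(i := z)) \<partial>A)" .
      have "y \<le> O' / v * v"
        unfolding y_def using O v H by (intro mult_left_mono) auto
      then have "ereal y \<le> budget I i" using O v by (simp add: order_trans[OF _ O(3)])
      then have "(1 - z) * y \<le> u"
        unfolding u_def using z \<kappa> y0 yV by (intro deviation_bound[OF i]) auto
      then show ?thesis unfolding y_def[symmetric] using z \<kappa> by (simp add: pos_le_divide_eq mult.commute)
    qed
    \<comment> \<open>For a fixed profile the threshold integral is applied to each item
      separately.\<close>
    have lower: "\<kappa> * v - (\<Sum>j\<in>items I. \<pi> j * top_bid I j a) \<le> (\<integral>z. h z a \<partial>N)"
      if a: "a \<in> space A" for a
    proof -
      have "\<pi> j * (\<kappa> * item_val I i j - top_bid I j a)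
        \<le> (\<integral>z. (if top_bid I j a < z * item_val I i j then \<pi> j * item_val I i j else 0) \<partial>N)"
        if j: "j \<in> items I" for j
      proof -
        have "0 \<le> top_bid I j a" using top_bid_bounds[OF _ j] a by (simp add: space_A)
        then show ?thesis
          unfolding N_def using \<pi>[OF j] item_val_nonneg[OF i j] by (intro integral_above_threshold)
      qed
      then have "(\<Sum>j\<in>items I. \<pi> j * (\<kappa> * item_val I i j - top_bid I j a))
        \<le> (\<Sum>j\<in>items I. \<integral>z. (if top_bid I j a < z * item_val I i j then \<pi> j * item_val I i j else 0) \<partial>N)"
        by (intro sum_mono)
      also have "\<dots> = (\<integral>z. h z a \<partial>N)"
        unfolding h_def
        by (intro Bochner_Integration.integral_sum[symmetric]
            N.integrable_const_bound[where B = "\<bar>\<pi> j * item_val I i j\<bar>" for j]) auto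
      finally show ?thesis
        by (simp add: v_def sum_distrib_left right_diff_distrib sum_subtractf mult_ac)
    qed
    have int_top: "integrable A (\<lambda>a. \<pi> j * top_bid I j a)" if "j \<in> items I" for j
      using integrable_top_bid[OF that] by simp
    have "\<kappa> * v - b = (\<integral>a. \<kappa> * v - (\<Sum>j\<in>items I. \<pi> j * top_bid I j a) \<partial>A)"
      using int_top by (simp add: b_def prob_space)
    also have "\<dots> \<le> (\<integral>a. (\<integral>z. h z a \<partial>N) \<partial>A)"
      using lower int_top NA.integrable_snd[OF int_h] by (intro integral_mono) auto
    also have "\<dots> = (\<integral>z. (\<integral>a. h z a \<partial>A) \<partial>N)"
      by (rule NA.Fubini_integral[OF int_h])
    finally have swap: "\<kappa> * v - b \<le> (\<integral>z. (\<integral>a. h z a \<partial>A) \<partial>N)" .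
    \<comment> \<open>The density has antiderivative \<open>- ln (1 - z)\<close>. As
      \<open>1 - \<kappa> = exp (- t)\<close>, its total mass on the interval is exactly
      \<open>t\<close>.\<close>
    have log_int: "has_bochner_integral lborel
        (\<lambda>z. indicator {0..\<kappa>} z *\<^sub>R (1 / (1 - z))) (- ln (1 - \<kappa>) - - ln (1 - 0))"
      using \<kappa> by (intro has_bochner_integral_FTC_Icc)
        (auto intro!: derivative_eq_intros continuous_intros
          simp: has_real_derivative_iff_has_vector_derivative[symmetric])
    have int_log: "integrable N (\<lambda>z. 1 / (1 - z))" "(\<integral>z. 1 / (1 - z) \<partial>N) = t"
      using log_int unfolding N_def
      by (auto simp: integrable_restrict_space integral_restrict_space has_bochner_integral_iff \<kappa>_def)
    have "O' / v * (\<kappa> * v - b) \<le> O' / v * (\<integral>z. (\<integral>a. h z a \<partial>A) \<partial>N)"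
      using swap O v by (intro mult_left_mono) auto
    also have "\<dots> = (\<integral>z. O' / v * (\<integral>a. h z a \<partial>A) \<partial>N)" by simp
    also have "\<dots> \<le> (\<integral>z. u * (1 / (1 - z)) \<partial>N)"
      using pointwise NA.integrable_fst[OF int_h]
      by (intro integral_mono integrable_mult_right int_log(1)) (auto simp: N_def space_restrict_space)
    also have "\<dots> = t * u" by (simp only: integral_mult_right_zero int_log(2) mult.commute)
    finally have "O' / v * (\<kappa> * v - b) \<le> t * u" .
    \<comment> \<open>Scaling turns \<open>\<kappa> * v\<close> into \<open>\<kappa> * O'\<close>
      and can only shrink the subtracted top bids.\<close>
    moreover have "O' / v * b \<le> 1 * b"
      using O v b by (intro mult_right_mono) (auto simp: v_def)
    moreover have "O' / v * (\<kappa> * v - b) = \<kappa> * O' - O' / v * b"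
      using v by (simp add: right_diff_distrib)
    ultimately show ?thesis by (simp add: \<kappa>_def u_def b_def)
  qed
qed

section \<open>Combining the capped and uncapped cases for one bidder\<close>

lemma expected_payment_le:
  assumes i: "i \<in> bidders I"
  shows "0 \<le> (\<integral>a. payment I i a \<partial>A)" "(\<integral>a. payment I i a \<partial>A) \<le> (\<integral>a. won_value I i a \<partial>A)"
    "ereal (\<integral>a. payment I i a \<partial>A) \<le> budget I i"
proof -
  show "0 \<le> (\<integral>a. payment I i a \<partial>A)"
    using component_in_unit(1)[OF _ i] won_value_nonneg[OF i]
    by (intro integral_nonneg_AE AE_I2) (simp add: payment_eq space_A)
  show "(\<integral>a. payment I i a \<partial>A) \<le> (\<integral>a. won_value I i a \<partial>A)"
  proof (rule integral_mono[OF integrable_payment[OF i] integrable_won_value[OF i]])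
    fix a assume "a \<in> space A"
    then show "payment I i a \<le> won_value I i a"
      using component_in_unit[OF _ i] won_value_nonneg[OF i]
      by (simp add: payment_eq space_A mult_left_le_one_le)
  qed
  show "ereal (\<integral>a. payment I i a \<partial>A) \<le> budget I i"
    using eq i by (simp add: coarse_correlated_equilibrium_def)
qed

text \<open>If the budget does not cap the value, then \<open>L\<close> minus the payment is the
  utility, and smoothness applies. If it does, then \<open>L\<close> is the budget, which bounds
  both \<open>O'\<close> and the payment. The equation for \<open>t\<close> says
  \<open>t - 1 = 1 - exp (- t)\<close>, so one inequality covers both cases.\<close>

lemma bidder_bound:
  fixes \<pi> :: "nat \<Rightarrow> real" and L O' t :: real
  assumes i: "i \<in> bidders I" and t: "t = 2 - exp (- t)" "0 \<le> t"
    and \<pi>: "\<And>j. j \<in> items I \<Longrightarrow> 0 \<le> \<pi> j" "\<And>j. j \<in> items I \<Longrightarrow> \<pi> j \<le> 1"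
    and O: "0 \<le> O'" "ereal O' = min (ereal (\<Sum>j\<in>items I. \<pi> j * item_val I i j)) (budget I i)"
    and L: "ereal L = min (ereal (\<integral>a. won_value I i a \<partial>A)) (budget I i)"
  shows "(1 - exp (- t)) * O' \<le> t * L - (\<integral>a. payment I i a \<partial>A)
    + (\<Sum>j\<in>items I. \<pi> j * (\<integral>a. top_bid I j a \<partial>A))"
proof -
  let ?x = "\<integral>a. won_value I i a \<partial>A" and ?p = "\<integral>a. payment I i a \<partial>A"
  let ?b = "\<Sum>j\<in>items I. \<pi> j * (\<integral>a. top_bid I j a \<partial>A)"
  have exp_le: "exp (- t) \<le> 1" using t(2) by simp
  note p = expected_payment_le[OF i]
  have O_le: "ereal O' \<le> budget I i" "O' \<le> (\<Sum>j\<in>items I. \<pi> j * item_val I i j)"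
    using O(2) by (metis min.cobounded2) (metis O(2) ereal_less_eq(3) min.cobounded1)
  show ?thesis
  proof (cases "ereal ?x \<le> budget I i")
    case True
    then have L: "L = ?x" using L by (simp add: min_def)
    have "(\<integral>a. utility I i a \<partial>A) = ?x - ?p"
      unfolding utility_def
      using integrable_won_value[OF i] integrable_payment[OF i] by simp
    moreover have "(1 - exp (- t)) * O' - ?b \<le> t * (\<integral>a. utility I i a \<partial>A)"
      using i t \<pi> O O_le by (intro utility_smoothness) auto
    \<comment> \<open>Smoothness subtracts \<open>t\<close> times the payment, whereas the claim
      subtracts it once; \<open>t \<ge> 1\<close> follows from
      \<open>exp (- t) \<le> 1\<close>.\<close>
    moreover have "1 * ?p \<le> t * ?p"
      using p t exp_le by (intro mult_right_mono) linarith+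
    ultimately show ?thesis by (simp add: L right_diff_distrib)
  next
    case False
    then have L: "ereal L = budget I i" using L by (simp add: min_def)
    have "O' \<le> L" "?p \<le> L" using O_le p L by (metis ereal_less_eq(3))+
    \<comment> \<open>One of the \<open>t\<close> copies of \<open>L\<close> is reserved for the
      payment; the other \<open>t - 1\<close> cover the scaled optimum.\<close>
    moreover from this have "(1 - exp (- t)) * O' \<le> (t - 1) * L"
      using exp_le t O by (intro mult_mono) linarith+
    moreover have "0 \<le> ?b"
      using \<pi> top_bid_bounds space_A
      by (intro sum_nonneg mult_nonneg_nonneg integral_nonneg_AE AE_I2) auto
    ultimately show ?thesis by (simp add: left_diff_distrib)
  qed
qed

section \<open>Summation over the bidders\<close>

text \<open>Truncated values are finite even when the budget is infinite, so the summation can be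
  carried out in the reals.\<close>

lemma truncate_real:
  fixes x :: real
  assumes "0 \<le> x" "0 < B"
  obtains y where "ereal y = min (ereal x) B" "0 \<le> y"
proof -
  have "min (ereal x) B = ereal (real_of_ereal (min (ereal x) B))"
    using assms by (cases B) (auto simp: min_def)
  moreover have "0 \<le> min (ereal x) B" using assms by (simp add: less_imp_le)
  ultimately show ?thesis using that by (metis ereal_less_eq(5))
qed

text \<open>Summing the bounds for single bidders, the weighted top bids total at most the revenue
  and are absorbed by the subtracted payments.\<close>

lemma welfare_bound:
  fixes t :: real
  assumes t: "t = 2 - exp (- t)" "0 < t" and D: "set_pmf D \<subseteq> allocations I"
  shows "(\<Sum>i\<in>bidders I.
      min (ereal (measure_pmf.expectation D (\<lambda>x. valuation I i (x i)))) (budget I i))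
    \<le> ereal (t / (1 - exp (- t))) * liquid_welfare I A"
proof -
  \<comment> \<open>Intersecting with \<open>allocations I\<close> makes these events disjoint for
    different bidders on the whole sample space, so that for each item the probabilities sum to at
    most 1.\<close>
  define \<pi> where "\<pi> i j = measure_pmf.prob D {x \<in> allocations I. j \<in> x i}" for i j
  have \<pi>: "0 \<le> \<pi> i j" "\<pi> i j \<le> 1" for i j by (simp_all add: \<pi>_def)
  have sum_\<pi>: "(\<Sum>i\<in>bidders I. \<pi> i j) \<le> 1" for j
  proof -
    have "disjoint_family_on (\<lambda>i. {x \<in> allocations I. j \<in> x i}) (bidders I)"
      by (fastforce simp: allocations_def disjoint_family_on_def)
    then have "(\<Sum>i\<in>bidders I. \<pi> i j)
      = measure_pmf.prob D (\<Union>i\<in>bidders I. {x \<in> allocations I. j \<in> x i})"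
      unfolding \<pi>_def by (intro measure_pmf.finite_measure_finite_Union[symmetric]) auto
    then show ?thesis by simp
  qed
  have val: "measure_pmf.expectation D (\<lambda>x. valuation I i (x i))
      = (\<Sum>j\<in>items I. \<pi> i j * item_val I i j)" if i: "i \<in> bidders I" for i
  proof -
    have "measure_pmf.expectation D (\<lambda>x. valuation I i (x i)) = measure_pmf.expectation D
      (\<lambda>x. \<Sum>j\<in>items I. indicator {x \<in> allocations I. j \<in> x i} x * item_val I i j)"
    proof (rule integral_cong_AE)
      show "AE x in measure_pmf D. valuation I i (x i)
        = (\<Sum>j\<in>items I. indicator {x \<in> allocations I. j \<in> x i} x * item_val I i j)"
      proof (simp only: AE_measure_pmf_iff, rule ballI)
        fix x assume "x \<in> set_pmf D"
        then have x: "x \<in> allocations I" using D by blast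
        then have "x i \<subseteq> items I" using i by (auto simp: allocations_def PiE_iff)
        then show "valuation I i (x i)
          = (\<Sum>j\<in>items I. indicator {x \<in> allocations I. j \<in> x i} x * item_val I i j)"
          unfolding valuation_def using x
          by (intro sum.mono_neutral_cong_left) auto
      qed
    qed auto
    also have "\<dots> = (\<Sum>j\<in>items I. measure_pmf.expectation D
        (\<lambda>x. indicator {x \<in> allocations I. j \<in> x i} x * item_val I i j))"
      by (intro Bochner_Integration.integral_sum integrable_mult_left)
        (auto intro!: measure_pmf.integrable_const_bound[where B = 1])
    also have "\<dots> = (\<Sum>j\<in>items I. \<pi> i j * item_val I i j)" by (simp add: \<pi>_def)
    finally show ?thesis .
  qed
  have "\<exists>y. ereal y = min (ereal (\<Sum>j\<in>items I. \<pi> i j * item_val I i j)) (budget I i) \<and> 0 \<le> y"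
    if "i \<in> bidders I" for i
  proof -
    have "0 \<le> (\<Sum>j\<in>items I. \<pi> i j * item_val I i j)"
      using \<pi> item_val_nonneg[OF that] by (intro sum_nonneg mult_nonneg_nonneg) auto
    from truncate_real[OF this budget_pos[OF that]] show ?thesis by metis
  qed
  then obtain Op where Op: "\<And>i. i \<in> bidders I \<Longrightarrow> 0 \<le> Op i" "\<And>i. i \<in> bidders I \<Longrightarrow>
      ereal (Op i) = min (ereal (\<Sum>j\<in>items I. \<pi> i j * item_val I i j)) (budget I i)"
    by metis
  have "\<exists>y. ereal y = min (ereal (\<integral>a. won_value I i a \<partial>A)) (budget I i)"
    if "i \<in> bidders I" for i
  proof -
    have "0 \<le> (\<integral>a. won_value I i a \<partial>A)"
      using won_value_nonneg[OF that] by (simp add: integral_nonneg_AE)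
    from truncate_real[OF this budget_pos[OF that]] show ?thesis by metis
  qed
  then obtain L where L: "\<And>i. i \<in> bidders I \<Longrightarrow>
      ereal (L i) = min (ereal (\<integral>a. won_value I i a \<partial>A)) (budget I i)"
    by metis
  let ?\<kappa> = "1 - exp (- t)"
  let ?m = "\<lambda>j. \<integral>a. top_bid I j a \<partial>A" and ?p = "\<lambda>i. \<integral>a. payment I i a \<partial>A"
  have "(\<Sum>i\<in>bidders I. \<Sum>j\<in>items I. \<pi> i j * ?m j) = (\<Sum>j\<in>items I. (\<Sum>i\<in>bidders I. \<pi> i j) * ?m j)"
    by (subst sum.swap) (simp add: sum_distrib_right)
  also have "\<dots> \<le> (\<Sum>j\<in>items I. ?m j)"
  proof (rule sum_mono)
    fix j assume "j \<in> items I"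
    then have "0 \<le> ?m j"
      using top_bid_bounds space_A by (intro integral_nonneg_AE AE_I2) auto
    then show "(\<Sum>i\<in>bidders I. \<pi> i j) * ?m j \<le> ?m j"
      using sum_\<pi>[of j] \<pi> by (intro mult_left_le_one_le) (auto intro: sum_nonneg)
  qed
  also have "\<dots> = (\<integral>a. (\<Sum>j\<in>items I. top_bid I j a) \<partial>A)"
    using integrable_top_bid by simp
  also have "\<dots> \<le> (\<integral>a. (\<Sum>i\<in>bidders I. payment I i a) \<partial>A)"
    using integrable_top_bid integrable_payment
    by (intro integral_mono Bochner_Integration.integrable_sum top_bid_le_payments)
      (auto simp: space_A component_in_unit)
  also have "\<dots> = (\<Sum>i\<in>bidders I. ?p i)"
    using integrable_payment by simp
  finally have revenue: "(\<Sum>i\<in>bidders I. \<Sum>j\<in>items I. \<pi> i j * ?m j) \<le> (\<Sum>i\<in>bidders I. ?p i)" .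
  have "?\<kappa> * (\<Sum>i\<in>bidders I. Op i) \<le> (\<Sum>i\<in>bidders I. t * L i - ?p i + (\<Sum>j\<in>items I. \<pi> i j * ?m j))"
    unfolding sum_distrib_left using t \<pi> Op L by (intro sum_mono bidder_bound) auto
  also have "\<dots> = t * (\<Sum>i\<in>bidders I. L i) - (\<Sum>i\<in>bidders I. ?p i)
      + (\<Sum>i\<in>bidders I. \<Sum>j\<in>items I. \<pi> i j * ?m j)"
    by (simp add: sum.distrib sum_subtractf sum_distrib_left)
  also have "\<dots> \<le> t * (\<Sum>i\<in>bidders I. L i)" using revenue by simp
  finally have "(\<Sum>i\<in>bidders I. Op i) \<le> t / ?\<kappa> * (\<Sum>i\<in>bidders I. L i)"
    using t(2) by (simp add: pos_le_divide_eq mult.commute)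
  moreover have "liquid_welfare I A = ereal (\<Sum>i\<in>bidders I. L i)"
    unfolding liquid_welfare_def sum_ereal[symmetric] using L by (intro sum.cong) auto
  moreover have "(\<Sum>i\<in>bidders I.
      min (ereal (measure_pmf.expectation D (\<lambda>x. valuation I i (x i)))) (budget I i))
      = ereal (\<Sum>i\<in>bidders I. Op i)"
    unfolding sum_ereal[symmetric] using Op(2) val by (intro sum.cong) auto
  ultimately show ?thesis by simp
qed

lemma liquid_welfare_nonneg: "0 \<le> liquid_welfare I A"
proof -
  have "0 \<le> (\<integral>a. won_value I i a \<partial>A)" if "i \<in> bidders I" for i
    using won_value_nonneg[OF that] by (simp add: integral_nonneg_AE)
  then show ?thesis
    unfolding liquid_welfare_def using budget_pos by (intro sum_nonneg) (auto simp: less_imp_le)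
qed

end

section \<open>The Lambert constant and the quotient of welfares\<close>

theorem theorem4p3:
  "price_of_anarchy
     \<le> ereal ((2 + lambert_W0 (- exp (- 2))) / (1 + lambert_W0 (- exp (- 2)))) \<and>
   (\<forall>I A. valid_auction I \<longrightarrow> coarse_correlated_equilibrium I A \<longrightarrow>
      optimal_liquid_welfare I
        \<le> ereal ((2 + lambert_W0 (- exp (- 2))) / (1 + lambert_W0 (- exp (- 2))))
            * liquid_welfare I A)"
proof -
  define w where "w = lambert_W0 (- exp (- 2))"
  define R where "R = (2 + w) / (1 + w)"
  have w: "- 1 \<le> w" "w < 0" "w * exp w = - exp (- 2)"
    using lambert_W0_exp_minus_2 by (simp_all add: w_def)
  \<comment> \<open>At -1 the function \<open>w * exp w\<close> takes the value
    \<open>- exp (- 1)\<close>, not \<open>- exp (- 2)\<close>.\<close>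
  have "w \<noteq> - 1" using w(3) by auto
  then have w1: "- 1 < w" using w(1) by simp
  \<comment> \<open>This shows that \<open>t = 2 + w\<close> solves \<open>t = 2 - exp (- t)\<close>
    and that \<open>1 - exp (- t) = 1 + w\<close>, so the ratio becomes \<open>R\<close>.\<close>
  have "exp (- (2 + w)) = exp (- 2) / exp w" by (simp add: exp_diff[symmetric])
  also have "\<dots> = - w" using w(3) by (simp add: field_simps)
  finally have exp_t: "exp (- (2 + w)) = - w" .
  have R: "0 \<le> R" using w1 by (simp add: R_def)
  have main: "optimal_liquid_welfare I \<le> ereal R * liquid_welfare I A" "0 \<le> liquid_welfare I A"
    if "valid_auction I" "coarse_correlated_equilibrium I A" for I A
  proof -
    interpret auction_equilibrium I A
      using that by unfold_locales
    show "optimal_liquid_welfare I \<le> ereal R * liquid_welfare I A"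
      unfolding optimal_liquid_welfare_def R_def
      using welfare_bound[of "2 + w"] w1 exp_t by (intro SUP_least) simp
    show "0 \<le> liquid_welfare I A" by (rule liquid_welfare_nonneg)
  qed
  have "optimal_liquid_welfare I / liquid_welfare I A \<le> ereal R"
    if "valid_auction I" "coarse_correlated_equilibrium I A" for I A
  proof (cases "liquid_welfare I A = 0")
    case True
    \<comment> \<open>Zero equilibrium welfare forces the optimum to be at most 0, which rules out
      an infinite quotient.\<close>
    then have "optimal_liquid_welfare I \<le> 0" using main(1)[OF that] by simp
    then have "optimal_liquid_welfare I / liquid_welfare I A \<le> 0"
      using True by (cases "optimal_liquid_welfare I") (auto simp: divide_ereal_def)
    then show ?thesis using R by (meson ereal_less_eq(5) order_trans)
  next
    case False
    then have "0 < liquid_welfare I A" using main(2)[OF that] by simp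
    then show ?thesis
      using main(1)[OF that] R
      by (cases "liquid_welfare I A"; cases "optimal_liquid_welfare I")
        (auto simp: divide_ereal_def field_simps)
  qed
  then have "price_of_anarchy \<le> ereal R"
    unfolding price_of_anarchy_def by (intro SUP_least) auto
  then show ?thesis using main(1) by (simp add: R_def w_def)
qed

end
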